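(* Let $\sigma$ be the one-dimensional real sign representation of $C_2$. If $X$ is an algebra in $C_2$-spaces over the little disks operad $\mathcal{D}(\sigma)$, then the non-trivial element of $C_2$ acts on $X$ as an anti-automorphism of $E_1$-algebras, i.e. it gives an isomorphism of $E_1$-algebras $i_e^\ast X\xrightarrow{\cong} i_e^\ast X^{op}$.
   Context: For $n\ge 0$, $\mathcal{D}(\sigma)_n$ is the space of $n$-tuples of nonoverlapping little disks in $\sigma$, where a little disk is a (not necessarily equivariant) affine map $D(\sigma)\to D(\sigma)$, $x\mapsto rx+c$ with $r>0$, on the unit disk $D(\sigma)=[-1,1]$. $C_2$ acts by conjugation, $\Sigma_n$ permutes the tuple, and the operad structure is by composition. $i_e^\ast$ denotes the underlying non-equivariant object; $i_e^\ast\mathcal{D}(\sigma)$ is the little intervals operad, an $E_1$-operad, so $i_e^\ast X$ is an $E_1$-algebra. $i_e^\ast X^{op}$ is the opposite $E_1$-algebra, i.e. the same space with the structure pulled back along the automorphism of the little intervals operad given by conjugation with the reflection $x\mapsto -x$ (which reverses the left-to-right order of intervals). *)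

theory Defs
  imports
    "HOL-Analysis.Analysis"
    "HOL-Algebra.Group_Action"
    "HOL-Algebra.Elementary_Groups"
    "HOL-Combinatorics.List_Permutation"
begin

section \<open>Blocks of indices\<close>

text \<open>
  A list \<open>js\<close> cuts \<open>{..<sum_list js}\<close> into consecutive blocks of lengths \<open>js ! a\<close>;
  \<open>slot js a b\<close> is the \<open>b\<close>-th index of the \<open>a\<close>-th block.
\<close>

definition slot :: "nat list \<Rightarrow> nat \<Rightarrow> nat \<Rightarrow> nat" where
  "slot js a b = sum_list (take a js) + b"

fun unslot :: "nat list \<Rightarrow> nat \<Rightarrow> nat \<times> nat" where
  "unslot [] i = (0, i)"
| "unslot (j # js) i = (if i < j then (0, i) else map_prod Suc id (unslot js (i - j)))"

lemma slot_less: "a < length js \<Longrightarrow> b < js ! a \<Longrightarrow> slot js a b < sum_list js"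
proof (induction js arbitrary: a)
  case (Cons j js) then show ?case
    by (cases a) (auto simp: slot_def)
qed (simp add: slot_def)

lemma unslot_slot: "a < length js \<Longrightarrow> b < js ! a \<Longrightarrow> unslot js (slot js a b) = (a, b)"
proof (induction js arbitrary: a)
  case (Cons j js) then show ?case
    by (cases a) (auto simp: slot_def)
qed (simp add: slot_def)

lemma slot_cases:
  assumes "i < sum_list js"
  obtains a b where "a < length js" "b < js ! a" "i = slot js a b"
  using assms
proof (induction js arbitrary: i thesis)
  case (Cons j js)
  show ?case
  proof (cases "i < j")
    case True
    then show ?thesis by (intro Cons.prems(1)[of 0 i]) (auto simp: slot_def)
  next
    case False
    with Cons.prems have "i - j < sum_list js" by auto
    then obtain a b where "a < length js" "b < js ! a" "i - j = slot js a b"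
      using Cons.IH by blast
    then show ?thesis using False by (intro Cons.prems(1)[of "Suc a" b]) (auto simp: slot_def)
  qed
qed simp

text \<open>
  The permutation which moves blocks around according to \<open>\<pi>\<close>, the \<open>a\<close>-th block (of length
  \<open>js ! \<pi> a\<close>) of the source going to the \<open>\<pi> a\<close>-th block of the target, and the block sum of
  permutations \<open>\<tau> a\<close>.
\<close>

definition block_perm :: "nat list \<Rightarrow> (nat \<Rightarrow> nat) \<Rightarrow> nat \<Rightarrow> nat" where
  "block_perm js \<pi> i =
     (if i < sum_list js
      then case unslot (permute_list \<pi> js) i of (a, b) \<Rightarrow> slot js (\<pi> a) b else i)"

definition block_sum :: "nat list \<Rightarrow> (nat \<Rightarrow> nat \<Rightarrow> nat) \<Rightarrow> nat \<Rightarrow> nat" where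
  "block_sum js \<tau> i =
     (if i < sum_list js then case unslot js i of (a, b) \<Rightarrow> slot js a (\<tau> a b) else i)"


section \<open>Spaces with a group action\<close>

text \<open>The group is discrete.\<close>

definition G_space :: "('g, 'b) monoid_scheme \<Rightarrow> 'x topology \<Rightarrow> ('g \<Rightarrow> 'x \<Rightarrow> 'x) \<Rightarrow> bool" where
  "G_space G X \<phi> \<longleftrightarrow>
     group_action G (topspace X) \<phi> \<and> (\<forall>g\<in>carrier G. continuous_map X X (\<phi> g))"

abbreviation power_space :: "'x topology \<Rightarrow> nat \<Rightarrow> (nat \<Rightarrow> 'x) topology" where
  "power_space X n \<equiv> product_topology (\<lambda>_. X) {..<n}"


section \<open>Operads and their algebras\<close>

text \<open>
  Symmetric operads in topological spaces, with the ordinary product topology and no separation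
  or compact generation hypotheses. \<open>op_comp P js\<close> is the composition product
  \<open>P(k) \<times> P(j\<^sub>1) \<times> \<dots> \<times> P(j\<^sub>k) \<rightarrow> P(j\<^sub>1 + \<dots> + j\<^sub>k)\<close> where \<open>js = [j\<^sub>1, \<dots>, j\<^sub>k]\<close>, and
  \<open>op_perm P n \<pi>\<close> is the right action of \<open>\<pi> \<in> \<Sigma>\<^sub>n\<close> on \<open>P(n)\<close>. Indices start at 0.
\<close>

record 'p operad =
  ops :: "nat \<Rightarrow> 'p topology"
  op_unit :: 'p
  op_comp :: "nat list \<Rightarrow> 'p \<Rightarrow> (nat \<Rightarrow> 'p) \<Rightarrow> 'p"
  op_perm :: "nat \<Rightarrow> (nat \<Rightarrow> nat) \<Rightarrow> 'p \<Rightarrow> 'p"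

abbreviation op_tuples :: "('p, 'm) operad_scheme \<Rightarrow> nat list \<Rightarrow> (nat \<Rightarrow> 'p) topology" where
  "op_tuples P js \<equiv> product_topology (\<lambda>a. ops P (js ! a)) {..<length js}"

locale topological_operad =
  fixes P :: "('p, 'm) operad_scheme"
  assumes unit_in: "op_unit P \<in> topspace (ops P 1)"
    and continuous_comp:
      "continuous_map (prod_topology (ops P (length js)) (op_tuples P js)) (ops P (sum_list js))
         (\<lambda>(p, q). op_comp P js p q)"
    and continuous_perm:
      "\<pi> permutes {..<n} \<Longrightarrow> continuous_map (ops P n) (ops P n) (op_perm P n \<pi>)"
    and perm_id: "p \<in> topspace (ops P n) \<Longrightarrow> op_perm P n id p = p"
    and perm_comp:
      "\<lbrakk>\<pi> permutes {..<n}; \<rho> permutes {..<n}; p \<in> topspace (ops P n)\<rbrakk>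
         \<Longrightarrow> op_perm P n (\<pi> \<circ> \<rho>) p = op_perm P n \<rho> (op_perm P n \<pi> p)"
    and unit_left:
      "p \<in> topspace (ops P n) \<Longrightarrow> op_comp P [n] (op_unit P) (\<lambda>a\<in>{..<1}. p) = p"
    and unit_right:
      "p \<in> topspace (ops P n)
         \<Longrightarrow> op_comp P (replicate n 1) p (\<lambda>a\<in>{..<n}. op_unit P) = p"
    and comp_assoc:
      "\<lbrakk>p \<in> topspace (ops P (length iss)); q \<in> topspace (op_tuples P (map length iss));
        r \<in> topspace (op_tuples P (concat iss))\<rbrakk>
         \<Longrightarrow> op_comp P (concat iss) (op_comp P (map length iss) p q) r =
             op_comp P (map sum_list iss) p
               (\<lambda>a\<in>{..<length iss}. op_comp P (iss ! a) (q a)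
                  (\<lambda>b\<in>{..<length (iss ! a)}. r (slot (map length iss) a b)))"
    and comp_perm_outer:
      "\<lbrakk>\<pi> permutes {..<length js}; p \<in> topspace (ops P (length js));
        q \<in> topspace (op_tuples P js)\<rbrakk>
         \<Longrightarrow> op_comp P (permute_list \<pi> js) (op_perm P (length js) \<pi> p)
               (\<lambda>a\<in>{..<length js}. q (\<pi> a)) =
             op_perm P (sum_list js) (block_perm js \<pi>) (op_comp P js p q)"
    and comp_perm_inner:
      "\<lbrakk>\<And>a. a < length js \<Longrightarrow> \<tau> a permutes {..<js ! a}; p \<in> topspace (ops P (length js));
        q \<in> topspace (op_tuples P js)\<rbrakk>
         \<Longrightarrow> op_comp P js p (\<lambda>a\<in>{..<length js}. op_perm P (js ! a) (\<tau> a) (q a)) =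
             op_perm P (sum_list js) (block_sum js \<tau>) (op_comp P js p q)"

locale operad_hom =
  fixes P :: "('p, 'm) operad_scheme" and Q :: "('q, 'n) operad_scheme"
    and h :: "nat \<Rightarrow> 'p \<Rightarrow> 'q"
  assumes continuous_hom: "continuous_map (ops P n) (ops Q n) (h n)"
    and hom_unit: "h 1 (op_unit P) = op_unit Q"
    and hom_comp:
      "\<lbrakk>p \<in> topspace (ops P (length js)); q \<in> topspace (op_tuples P js)\<rbrakk>
         \<Longrightarrow> h (sum_list js) (op_comp P js p q) =
             op_comp Q js (h (length js) p) (\<lambda>a\<in>{..<length js}. h (js ! a) (q a))"
    and hom_perm:
      "\<lbrakk>\<pi> permutes {..<n}; p \<in> topspace (ops P n)\<rbrakk>
         \<Longrightarrow> h n (op_perm P n \<pi> p) = op_perm Q n \<pi> (h n p)"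

definition operad_automorphism :: "('p, 'm) operad_scheme \<Rightarrow> (nat \<Rightarrow> 'p \<Rightarrow> 'p) \<Rightarrow> bool" where
  "operad_automorphism P h \<longleftrightarrow>
     operad_hom P P h \<and>
     (\<exists>k. operad_hom P P k \<and>
       (\<forall>n. \<forall>p\<in>topspace (ops P n). k n (h n p) = p \<and> h n (k n p) = p))"

record ('p, 'x) algebra =
  alg_space :: "'x topology"
  alg_act :: "nat \<Rightarrow> 'p \<Rightarrow> (nat \<Rightarrow> 'x) \<Rightarrow> 'x"

locale operad_algebra =
  fixes P :: "('p, 'm) operad_scheme" and A :: "('p, 'x, 'n) algebra_scheme"
  assumes continuous_act:
      "continuous_map (prod_topology (ops P n) (power_space (alg_space A) n)) (alg_space A)
         (\<lambda>(p, x). alg_act A n p x)"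
    and act_unit:
      "x \<in> topspace (power_space (alg_space A) 1) \<Longrightarrow> alg_act A 1 (op_unit P) x = x 0"
    and act_comp:
      "\<lbrakk>p \<in> topspace (ops P (length js)); q \<in> topspace (op_tuples P js);
        x \<in> topspace (power_space (alg_space A) (sum_list js))\<rbrakk>
         \<Longrightarrow> alg_act A (sum_list js) (op_comp P js p q) x =
             alg_act A (length js) p
               (\<lambda>a\<in>{..<length js}. alg_act A (js ! a) (q a) (\<lambda>b\<in>{..<js ! a}. x (slot js a b)))"
    and act_perm:
      "\<lbrakk>\<pi> permutes {..<n}; p \<in> topspace (ops P n);
        x \<in> topspace (power_space (alg_space A) n)\<rbrakk>
         \<Longrightarrow> alg_act A n (op_perm P n \<pi> p) x =
             alg_act A n p (\<lambda>i\<in>{..<n}. x (inv_into UNIV \<pi> i))"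

locale algebra_hom =
  dom: operad_algebra P A + cod: operad_algebra P B
  for P :: "('p, 'm) operad_scheme" and A :: "('p, 'x, 'n) algebra_scheme"
    and B :: "('p, 'y, 'k) algebra_scheme" +
  fixes f :: "'x \<Rightarrow> 'y"
  assumes continuous_hom: "continuous_map (alg_space A) (alg_space B) f"
    and hom_act:
      "\<lbrakk>p \<in> topspace (ops P n); x \<in> topspace (power_space (alg_space A) n)\<rbrakk>
         \<Longrightarrow> f (alg_act A n p x) = alg_act B n p (\<lambda>i\<in>{..<n}. f (x i))"

definition algebra_iso ::
  "('p, 'm) operad_scheme \<Rightarrow> ('p, 'x, 'n) algebra_scheme \<Rightarrow> ('p, 'y, 'k) algebra_scheme
     \<Rightarrow> ('x \<Rightarrow> 'y) \<Rightarrow> bool" where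
  "algebra_iso P A B f \<longleftrightarrow>
     algebra_hom P A B f \<and>
     (\<exists>g. algebra_hom P B A g \<and>
       (\<forall>x\<in>topspace (alg_space A). g (f x) = x) \<and> (\<forall>y\<in>topspace (alg_space B). f (g y) = y))"

definition algebra_pullback ::
  "(nat \<Rightarrow> 'p \<Rightarrow> 'q) \<Rightarrow> ('q, 'x, 'n) algebra_scheme \<Rightarrow> ('p, 'x) algebra" where
  "algebra_pullback h A =
     \<lparr>alg_space = alg_space A, alg_act = (\<lambda>n p. alg_act A n (h n p))\<rparr>"


section \<open>Operads and algebras in G-spaces\<close>

record ('g, 'p) G_operad = "'p operad" +
  op_G :: "'g \<Rightarrow> nat \<Rightarrow> 'p \<Rightarrow> 'p"

locale equivariant_operad = topological_operad P
  for G :: "('g, 'b) monoid_scheme" and P :: "('g, 'p, 'm) G_operad_scheme" +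
  assumes ops_G_space: "G_space G (ops P n) (\<lambda>g. op_G P g n)"
    and G_hom: "g \<in> carrier G \<Longrightarrow> operad_hom P P (op_G P g)"

record ('g, 'p, 'x) G_algebra = "('p, 'x) algebra" +
  alg_G :: "'g \<Rightarrow> 'x \<Rightarrow> 'x"

locale equivariant_algebra = operad_algebra P A
  for G :: "('g, 'b) monoid_scheme" and P :: "('g, 'p, 'm) G_operad_scheme"
    and A :: "('g, 'p, 'x, 'n) G_algebra_scheme" +
  assumes alg_G_space: "G_space G (alg_space A) (alg_G A)"
    and act_G:
      "\<lbrakk>g \<in> carrier G; p \<in> topspace (ops P n); x \<in> topspace (power_space (alg_space A) n)\<rbrakk>
         \<Longrightarrow> alg_G A g (alg_act A n p x) =
             alg_act A n (op_G P g n p) (\<lambda>i\<in>{..<n}. alg_G A g (x i))"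


section \<open>The little disks operad of the sign representation\<close>

text \<open>\<open>integer_mod_group 2\<close> has carrier \<open>{0, 1}\<close>.\<close>

abbreviation C2 :: "int monoid" where
  "C2 \<equiv> integer_mod_group 2"

definition sign_rep :: "int \<Rightarrow> real \<Rightarrow> real" where
  "sign_rep g x = (if g = \<one>\<^bsub>C2\<^esub> then x else - x)"

abbreviation disk :: "real set" where
  "disk \<equiv> {-1..1}"

definition affine_disk :: "real \<Rightarrow> real \<Rightarrow> real \<Rightarrow> real" where
  "affine_disk r c = (\<lambda>x\<in>disk. r * x + c)"

definition little_disks :: "(real \<Rightarrow> real) set" where
  "little_disks = {f. \<exists>r c. r > 0 \<and> f = affine_disk r c \<and> f ` disk \<subseteq> disk}"

text \<open>
  Disks are nonoverlapping if the images of the open unit disk are disjoint, so the closed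
  images may touch at an endpoint. A tuple is a function on \<open>{..<n}\<close>; there is exactly one
  tuple for \<open>n = 0\<close>.
\<close>

definition disk_tuples :: "nat \<Rightarrow> (nat \<Rightarrow> real \<Rightarrow> real) set" where
  "disk_tuples n =
     {c \<in> {..<n} \<rightarrow>\<^sub>E little_disks.
        \<forall>i<n. \<forall>j<n. i \<noteq> j \<longrightarrow> c i ` {-1<..<1} \<inter> c j ` {-1<..<1} = {}}"

text \<open>
  The usual topology on maps \<open>disk \<rightarrow> disk\<close>, restricted to affine maps, is that of pointwise
  convergence; equivalently (see \<open>homeomorphic_map_affine_disk\<close> below) it is the topology of
  the parameters \<open>(r, c)\<close>.
\<close>

abbreviation disk_maps :: "(real \<Rightarrow> real) topology" where
  "disk_maps \<equiv> powertop_real disk"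

definition disk_space :: "nat \<Rightarrow> (nat \<Rightarrow> real \<Rightarrow> real) topology" where
  "disk_space n = subtopology (power_space disk_maps n) (disk_tuples n)"

definition disk_comp ::
  "nat list \<Rightarrow> (nat \<Rightarrow> real \<Rightarrow> real) \<Rightarrow> (nat \<Rightarrow> nat \<Rightarrow> real \<Rightarrow> real) \<Rightarrow> nat \<Rightarrow> real \<Rightarrow> real" where
  "disk_comp js c d =
     (\<lambda>i\<in>{..<sum_list js}. case unslot js i of (a, b) \<Rightarrow> compose disk (c a) (d a b))"

text \<open>\<open>conjugate h h' f\<close> is \<open>h \<circ> f \<circ> h'\<close> on the unit disk; it is used with \<open>h' = h\<^sup>-\<^sup>1\<close>.\<close>

definition conjugate :: "(real \<Rightarrow> real) \<Rightarrow> (real \<Rightarrow> real) \<Rightarrow> (real \<Rightarrow> real) \<Rightarrow> real \<Rightarrow> real" where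
  "conjugate h h' f = (\<lambda>x\<in>disk. h (f (h' x)))"

definition disks_sigma :: "(int, nat \<Rightarrow> real \<Rightarrow> real) G_operad" where
  "disks_sigma =
     \<lparr>ops = disk_space,
      op_unit = (\<lambda>i\<in>{..<1}. \<lambda>x\<in>disk. x),
      op_comp = disk_comp,
      op_perm = (\<lambda>n \<pi> c. \<lambda>i\<in>{..<n}. c (\<pi> i)),
      op_G = (\<lambda>g n. \<lambda>c\<in>disk_tuples n. \<lambda>i\<in>{..<n}.
                conjugate (sign_rep g) (sign_rep (inv\<^bsub>C2\<^esub> g)) (c i))\<rparr>"

text \<open>Forgetting the group action; \<open>E1\<close> is the little intervals operad.\<close>

definition underlying_operad :: "('g, 'p) G_operad \<Rightarrow> 'p operad" where
  "underlying_operad P = operad.truncate P"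

definition underlying_algebra :: "('g, 'p, 'x) G_algebra \<Rightarrow> ('p, 'x) algebra" where
  "underlying_algebra A = algebra.truncate A"

definition E1 :: "(nat \<Rightarrow> real \<Rightarrow> real) operad" where
  "E1 = underlying_operad disks_sigma"

definition reflect_disks :: "nat \<Rightarrow> (nat \<Rightarrow> real \<Rightarrow> real) \<Rightarrow> nat \<Rightarrow> real \<Rightarrow> real" where
  "reflect_disks n c = (\<lambda>i\<in>{..<n}. conjugate uminus uminus (c i))"

definition opposite_algebra ::
  "(nat \<Rightarrow> real \<Rightarrow> real, 'x) algebra \<Rightarrow> (nat \<Rightarrow> real \<Rightarrow> real, 'x) algebra" where
  "opposite_algebra A = algebra_pullback reflect_disks A"

section \<open>The little disks form an equivariant operad\<close>

lemma ops_E1 [simp]: "ops E1 = disk_space"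
  and unit_E1 [simp]: "op_unit E1 = (\<lambda>i\<in>{..<1}. \<lambda>x\<in>disk. x)"
  and comp_E1 [simp]: "op_comp E1 = disk_comp"
  and perm_E1 [simp]: "op_perm E1 = (\<lambda>n \<pi> c. \<lambda>i\<in>{..<n}. c (\<pi> i))"
  by (simp_all add: E1_def underlying_operad_def disks_sigma_def operad.truncate_def)

lemma ops_disks_sigma [simp]: "ops disks_sigma = disk_space"
  and unit_disks_sigma [simp]: "op_unit disks_sigma = (\<lambda>i\<in>{..<1}. \<lambda>x\<in>disk. x)"
  and comp_disks_sigma [simp]: "op_comp disks_sigma = disk_comp"
  and perm_disks_sigma [simp]: "op_perm disks_sigma = (\<lambda>n \<pi> c. \<lambda>i\<in>{..<n}. c (\<pi> i))"
  by (simp_all add: disks_sigma_def)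

lemma affine_image_disk:
  assumes "r > 0"
  shows "affine_disk r c ` disk \<subseteq> disk \<longleftrightarrow> r + \<bar>c\<bar> \<le> 1"
proof
  assume "affine_disk r c ` disk \<subseteq> disk"
  then have "affine_disk r c 1 \<in> disk" "affine_disk r c (-1) \<in> disk"
    by (simp_all add: image_subset_iff)
  then show "r + \<bar>c\<bar> \<le> 1" by (auto simp: affine_disk_def)
next
  assume *: "r + \<bar>c\<bar> \<le> 1"
  have "r * x + c \<in> disk" if "x \<in> disk" for x
  proof -
    have "r * x \<le> r * 1" "r * (-1) \<le> r * x"
      using that assms by (intro mult_left_mono; simp)+
    then show ?thesis using * by auto
  qed
  then show "affine_disk r c ` disk \<subseteq> disk" by (auto simp: affine_disk_def)
qed

lemma little_disksE:
  assumes "f \<in> little_disks"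
  obtains r c where "r > 0" "r + \<bar>c\<bar> \<le> 1" "f = affine_disk r c"
  using assms affine_image_disk unfolding little_disks_def by blast

lemma little_disksI: "r > 0 \<Longrightarrow> r + \<bar>c\<bar> \<le> 1 \<Longrightarrow> affine_disk r c \<in> little_disks"
  using affine_image_disk unfolding little_disks_def by blast

lemma little_disk_maps_disk: "f \<in> little_disks \<Longrightarrow> x \<in> disk \<Longrightarrow> f x \<in> disk"
  unfolding little_disks_def by blast

lemma little_disk_maps_open: "f \<in> little_disks \<Longrightarrow> f ` {-1<..<1} \<subseteq> {-1<..<1}"
proof (elim little_disksE, intro subsetI, elim imageE)
  fix r c x y :: real
  assume *: "r > 0" "r + \<bar>c\<bar> \<le> 1" "f = affine_disk r c" "y = f x" "x \<in> {-1<..<1}"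
  have "r * x < r" "- r < r * x"
    using * mult_strict_left_mono[of x 1 r] mult_strict_left_mono[of "-1" x r] by auto
  then have "r * x + c \<in> {-1<..<1}"
    using *(2) unfolding greaterThanLessThan_iff by linarith
  then show "y \<in> {-1<..<1}" using *(3-5) by (simp add: affine_disk_def)
qed

lemma little_disk_extensional: "f \<in> little_disks \<Longrightarrow> f \<in> extensional disk"
  by (auto simp: little_disks_def affine_disk_def)

lemma little_disk_inj: "f \<in> little_disks \<Longrightarrow> inj_on f disk"
  by (elim little_disksE) (auto simp: affine_disk_def inj_on_def)

lemma little_disk_affine:
  "f \<in> little_disks \<Longrightarrow> x \<in> disk \<Longrightarrow> f x = (f 1 - f (-1)) / 2 * x + (f 1 + f (-1)) / 2"
  by (elim little_disksE) (auto simp: affine_disk_def)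

lemma little_disk_id: "(\<lambda>x\<in>disk. x) \<in> little_disks"
  using little_disksI[of 1 0] by (simp add: affine_disk_def)

lemma little_disk_compose:
  assumes "f \<in> little_disks" "g \<in> little_disks"
  shows "compose disk f g \<in> little_disks"
proof -
  obtain r c where f: "r > 0" "f = affine_disk r c" using assms(1) by (elim little_disksE)
  obtain s d where g: "s > 0" "g = affine_disk s d" using assms(2) by (elim little_disksE)
  have "compose disk f g x = affine_disk (r * s) (r * d + c) x" for x
  proof (cases "x \<in> disk")
    case True
    then have "g x \<in> disk" using assms(2) little_disk_maps_disk by blast
    with True show ?thesis
      unfolding compose_def f(2) g(2) affine_disk_def
      by (simp add: algebra_simps del: atLeastAtMost_iff)
  qed (simp add: compose_def affine_disk_def del: atLeastAtMost_iff)
  then have eq: "compose disk f g = affine_disk (r * s) (r * d + c)" by blast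
  have "compose disk f g ` disk \<subseteq> disk"
    using little_disk_maps_disk[OF assms(1)] little_disk_maps_disk[OF assms(2)]
    unfolding compose_def by (intro image_subsetI) (simp del: atLeastAtMost_iff)
  moreover have "r * s > 0" using f g by simp
  ultimately show ?thesis using eq unfolding little_disks_def by blast
qed

lemma little_disks_subset: "little_disks \<subseteq> topspace disk_maps"
  by (intro subsetI) (simp add: PiE_def little_disk_extensional)

lemma homeomorphic_map_affine_disk:
  "homeomorphic_map (top_of_set {(r, c). 0 < r \<and> r + \<bar>c\<bar> \<le> 1})
     (subtopology disk_maps little_disks) (\<lambda>(r, c). affine_disk r c)"
proof -
  define S where "S = {(r, c::real). 0 < r \<and> r + \<bar>c\<bar> \<le> 1}"
  define F where "F = (\<lambda>(r, c). affine_disk r c)"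
  define H where "H = (\<lambda>f::real \<Rightarrow> real. ((f 1 - f (-1)) / 2, (f 1 + f (-1)) / 2))"
  let ?L = "subtopology disk_maps little_disks"
  have topL: "topspace ?L = little_disks"
    using little_disks_subset by auto
  have F_in: "F p \<in> little_disks" if "p \<in> S" for p
    using that little_disksI by (auto simp: F_def S_def)
  have HF: "H (F p) = p" for p
    by (cases p) (simp add: F_def H_def affine_disk_def)
  have H_in: "H f \<in> S \<and> F (H f) = f" if f: "f \<in> little_disks" for f
  proof -
    obtain r c where rc: "r > 0" "r + \<bar>c\<bar> \<le> 1" "f = affine_disk r c"
      using f by (rule little_disksE)
    then have "f = F (r, c)" "(r, c) \<in> S" by (simp_all add: F_def S_def)
    then show ?thesis using HF by simp
  qed
  have ev: "continuous_map ?L euclideanreal (\<lambda>f. f x)" if "x \<in> disk" for x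
    using that by (intro continuous_map_from_subtopology continuous_map_product_projection)
  have "continuous_map (top_of_set S) ?L F"
    unfolding continuous_map_in_subtopology continuous_map_componentwise
  proof (intro conjI ballI)
    show "F ` topspace (top_of_set S) \<subseteq> extensional disk"
      using F_in little_disk_extensional by auto
    show "F \<in> topspace (top_of_set S) \<rightarrow> little_disks"
      using F_in by auto
    fix x :: real assume x: "x \<in> disk"
    have "continuous_on S (\<lambda>p. fst p * x + snd p)"
      by (intro continuous_intros)
    moreover have "F p x = fst p * x + snd p" for p
      using x by (simp add: F_def affine_disk_def case_prod_beta del: atLeastAtMost_iff)
    ultimately show "continuous_map (top_of_set S) euclideanreal (\<lambda>p. F p x)"
      by simp
  qed
  moreover have "continuous_map ?L (top_of_set S) H"
  proof -
    have "continuous_map ?L (prod_topology euclideanreal euclideanreal) H"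
      unfolding continuous_map_pairwise H_def o_def fst_conv snd_conv
      by (intro conjI continuous_map_real_divide continuous_map_diff continuous_map_add ev
        continuous_map_canonical_const) auto
    then have "continuous_map ?L euclidean H" by simp
    moreover have "H \<in> topspace ?L \<rightarrow> S" using H_in topL by blast
    ultimately show ?thesis unfolding continuous_map_in_subtopology by blast
  qed
  ultimately have "homeomorphic_maps (top_of_set S) ?L F H"
    unfolding homeomorphic_maps_def topL using HF H_in by simp
  then show ?thesis unfolding homeomorphic_map_maps S_def F_def by blast
qed

lemma topspace_disk_space [simp]: "topspace (disk_space n) = disk_tuples n"
proof -
  have "disk_tuples n \<subseteq> {..<n} \<rightarrow>\<^sub>E little_disks" unfolding disk_tuples_def by blast
  also have "\<dots> \<subseteq> {..<n} \<rightarrow>\<^sub>E topspace disk_maps"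
    using little_disks_subset by (intro PiE_mono)
  finally show ?thesis by (auto simp: disk_space_def)
qed

lemma disk_tuplesD:
  assumes "c \<in> disk_tuples n"
  shows "i < n \<Longrightarrow> c i \<in> little_disks" "c \<in> extensional {..<n}"
    "\<lbrakk>i < n; j < n; i \<noteq> j\<rbrakk> \<Longrightarrow> c i ` {-1<..<1} \<inter> c j ` {-1<..<1} = {}"
  using assms by (auto simp: disk_tuples_def PiE_iff)

lemma continuous_eval_disk:
  assumes "i < n" "x \<in> disk"
  shows "continuous_map (disk_space n) euclideanreal (\<lambda>c. c i x)"
proof -
  have "continuous_map (power_space disk_maps n) disk_maps (\<lambda>c. c i)"
    using assms continuous_map_product_projection[of i "{..<n}" "\<lambda>_. disk_maps"] by simp
  moreover have "continuous_map disk_maps euclideanreal (\<lambda>f. f x)"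
    using assms continuous_map_product_projection[of x disk "\<lambda>_. euclideanreal"] by blast
  ultimately have "continuous_map (power_space disk_maps n) euclideanreal ((\<lambda>f. f x) \<circ> (\<lambda>c. c i))"
    by (rule continuous_map_compose)
  then show ?thesis
    unfolding disk_space_def o_def by (rule continuous_map_from_subtopology)
qed

lemma continuous_into_disk_space:
  assumes "\<And>t. t \<in> topspace T \<Longrightarrow> F t \<in> disk_tuples n"
    and "\<And>i x. i < n \<Longrightarrow> x \<in> disk \<Longrightarrow> continuous_map T euclideanreal (\<lambda>t. F t i x)"
  shows "continuous_map T (disk_space n) F"
  unfolding disk_space_def continuous_map_in_subtopology continuous_map_componentwise
proof (intro conjI ballI)
  show "F ` topspace T \<subseteq> extensional {..<n}" using assms(1) disk_tuplesD(2) by blast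
  show "F \<in> topspace T \<rightarrow> disk_tuples n" using assms(1) by auto
  fix i assume "i \<in> {..<n}"
  then show "(\<lambda>t. F t i) ` topspace T \<subseteq> extensional disk"
    using assms(1) disk_tuplesD(1) little_disk_extensional by blast
  fix x assume "x \<in> disk"
  then show "continuous_map T euclideanreal (\<lambda>t. F t i x)"
    using assms(2) \<open>i \<in> {..<n}\<close> by simp
qed

lemma disk_comp_slot:
  assumes "a < length js" "b < js ! a"
  shows "disk_comp js c d (slot js a b) = compose disk (c a) (d a b)"
  using assms by (simp add: disk_comp_def slot_less unslot_slot)

lemma compose_image_open:
  assumes "g \<in> little_disks"
  shows "compose disk f g ` {-1<..<1} = f ` g ` {-1<..<1}"
proof -
  have "compose disk f g ` {-1<..<1} = (\<lambda>x. f (g x)) ` {-1<..<1}"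
    by (intro image_cong) (auto simp: compose_def)
  then show ?thesis by (simp add: image_image)
qed

lemma disk_comp_in:
  assumes c: "c \<in> disk_tuples (length js)"
    and d: "\<And>a. a < length js \<Longrightarrow> d a \<in> disk_tuples (js ! a)"
  shows "disk_comp js c d \<in> disk_tuples (sum_list js)"
proof -
  have cL: "c a \<in> little_disks" if "a < length js" for a
    using disk_tuplesD(1)[OF c that] .
  have dL: "d a b \<in> little_disks" if "a < length js" "b < js ! a" for a b
    using disk_tuplesD(1)[OF d[OF that(1)] that(2)] .
  have "disk_comp js c d i \<in> little_disks" if i: "i < sum_list js" for i
  proof -
    obtain a b where ab: "a < length js" "b < js ! a" "i = slot js a b"
      using i by (rule slot_cases)
    show ?thesis
      unfolding ab(3) disk_comp_slot[OF ab(1,2)]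
      by (rule little_disk_compose[OF cL[OF ab(1)] dL[OF ab(1,2)]])
  qed
  moreover have "disk_comp js c d i ` {-1<..<1} \<inter> disk_comp js c d i' ` {-1<..<1} = {}"
    if i: "i < sum_list js" "i' < sum_list js" "i \<noteq> i'" for i i'
  proof -
    obtain a b where ab: "a < length js" "b < js ! a" "i = slot js a b"
      using i(1) by (rule slot_cases)
    obtain a' b' where ab': "a' < length js" "b' < js ! a'" "i' = slot js a' b'"
      using i(2) by (rule slot_cases)
    let ?U = "d a b ` {-1<..<1}" and ?V = "d a' b' ` {-1<..<1}"
    have sub: "?U \<subseteq> {-1<..<1}" "?V \<subseteq> {-1<..<1}"
      using little_disk_maps_open dL ab(1,2) ab'(1,2) by blast+
    have "c a ` ?U \<inter> c a' ` ?V = {}"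
    proof (cases "a = a'")
      case False
      then have "c a ` {-1<..<1} \<inter> c a' ` {-1<..<1} = {}"
        using disk_tuplesD(3)[OF c ab(1) ab'(1)] by blast
      then show ?thesis using sub by blast
    next
      case True
      with i(3) ab(3) ab'(3) have "b \<noteq> b'" by blast
      then have "?U \<inter> ?V = {}"
        using disk_tuplesD(3)[OF d[OF ab(1)] ab(2)] ab'(2) True by blast
      moreover have "{-1<..<1} \<subseteq> disk" by auto
      ultimately have "c a ` ?U \<inter> c a ` ?V = {}"
        using inj_on_image_Int[OF little_disk_inj[OF cL[OF ab(1)]], of ?U ?V] sub by simp
      then show ?thesis using True by simp
    qed
    then show ?thesis
      unfolding ab(3) ab'(3) disk_comp_slot[OF ab(1,2)] disk_comp_slot[OF ab'(1,2)]
        compose_image_open[OF dL[OF ab(1,2)]] compose_image_open[OF dL[OF ab'(1,2)]] .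
  qed
  moreover have "disk_comp js c d \<in> extensional {..<sum_list js}"
    by (simp add: disk_comp_def)
  ultimately show ?thesis by (simp add: disk_tuples_def PiE_iff)
qed

lemma disk_tuplesI:
  assumes "\<And>i. i < n \<Longrightarrow> c i \<in> little_disks" "c \<in> extensional {..<n}"
    "\<And>i j. \<lbrakk>i < n; j < n; i \<noteq> j\<rbrakk> \<Longrightarrow> c i ` {-1<..<1} \<inter> c j ` {-1<..<1} = {}"
  shows "c \<in> disk_tuples n"
  using assms by (simp add: disk_tuples_def PiE_iff)

lemma disk_perm_in:
  assumes p: "\<pi> permutes {..<n}" and c: "c \<in> disk_tuples n"
  shows "(\<lambda>i\<in>{..<n}. c (\<pi> i)) \<in> disk_tuples n"
proof (rule disk_tuplesI)
  have less: "\<pi> i < n" if "i < n" for i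
    using permutes_in_image[OF p, of i] that by simp
  show "(\<lambda>i\<in>{..<n}. c (\<pi> i)) i \<in> little_disks" if "i < n" for i
    using disk_tuplesD(1)[OF c less] that by simp
  fix i j assume ij: "i < n" "j < n" "i \<noteq> j"
  then have "\<pi> i \<noteq> \<pi> j" using injD[OF permutes_inj[OF p]] by blast
  then have "c (\<pi> i) ` {-1<..<1} \<inter> c (\<pi> j) ` {-1<..<1} = {}"
    by (rule disk_tuplesD(3)[OF c less[OF ij(1)] less[OF ij(2)]])
  then show "(\<lambda>i\<in>{..<n}. c (\<pi> i)) i ` {-1<..<1} \<inter> (\<lambda>i\<in>{..<n}. c (\<pi> i)) j ` {-1<..<1} = {}"
    using ij by simp
qed simp

lemma continuous_disk_comp:
  "continuous_map
     (prod_topology (disk_space (length js))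
        (product_topology (\<lambda>a. disk_space (js ! a)) {..<length js}))
     (disk_space (sum_list js)) (\<lambda>(c, d). disk_comp js c d)"
  (is "continuous_map ?T _ _")
proof (rule continuous_into_disk_space)
  have top: "fst t \<in> disk_tuples (length js)" "a < length js \<Longrightarrow> snd t a \<in> disk_tuples (js ! a)"
    if "t \<in> topspace ?T" for t a
    using that by (simp_all add: mem_Times_iff PiE_iff)
  show "(case t of (c, d) \<Rightarrow> disk_comp js c d) \<in> disk_tuples (sum_list js)"
    if "t \<in> topspace ?T" for t
    unfolding case_prod_beta using top[OF that] by (rule disk_comp_in)
  fix i x assume i: "i < sum_list js" and x: "x \<in> disk"
  obtain a b where ab: "a < length js" "b < js ! a" "i = slot js a b"
    using i by (rule slot_cases)
  have c: "continuous_map ?T euclideanreal (\<lambda>t. fst t a y)" if "y \<in> disk" for y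
    using continuous_map_compose[OF continuous_map_fst continuous_eval_disk[OF ab(1) that]]
    unfolding o_def .
  have "continuous_map (product_topology (\<lambda>a. disk_space (js ! a)) {..<length js})
          (disk_space (js ! a)) (\<lambda>d. d a)"
    using continuous_map_product_projection[of a "{..<length js}" "\<lambda>a. disk_space (js ! a)"] ab(1)
    by simp
  from continuous_map_compose[OF continuous_map_snd
      continuous_map_compose[OF this continuous_eval_disk[OF ab(2) x]]]
  have d: "continuous_map ?T euclideanreal (\<lambda>t. snd t a b x)"
    unfolding o_def .
  have "continuous_map ?T euclideanreal
          (\<lambda>t. (fst t a 1 - fst t a (-1)) / 2 * snd t a b x + (fst t a 1 + fst t a (-1)) / 2)"
    by (intro continuous_map_real_divide continuous_map_real_mult continuous_map_diff
      continuous_map_add c d continuous_map_canonical_const) auto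
  then show "continuous_map ?T euclideanreal (\<lambda>t. (case t of (c, d) \<Rightarrow> disk_comp js c d) i x)"
  proof (rule continuous_map_eq)
    fix t assume t: "t \<in> topspace ?T"
    have f: "fst t a \<in> little_disks" by (rule disk_tuplesD(1)[OF top(1)[OF t] ab(1)])
    have "snd t a b \<in> little_disks" by (rule disk_tuplesD(1)[OF top(2)[OF t ab(1)] ab(2)])
    then have y: "snd t a b x \<in> disk" using x by (rule little_disk_maps_disk)
    have "(case t of (c, d) \<Rightarrow> disk_comp js c d) i x = compose disk (fst t a) (snd t a b) x"
      unfolding case_prod_beta ab(3) disk_comp_slot[OF ab(1,2)] by simp
    also have "\<dots> = fst t a (snd t a b x)" using x by (rule compose_eq)
    finally show "(fst t a 1 - fst t a (-1)) / 2 * snd t a b x + (fst t a 1 + fst t a (-1)) / 2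
        = (case t of (c, d) \<Rightarrow> disk_comp js c d) i x"
      by (simp only: little_disk_affine[OF f y])
  qed
qed

lemma sum_list_map_sum_list: "sum_list (map sum_list iss) = sum_list (concat iss)" for iss :: "nat list list"
  by (induction iss) auto

lemma slot_concat:
  assumes "a < length iss" "b < length (iss ! a)"
  shows "slot (concat iss) (slot (map length iss) a b) e
       = slot (map sum_list iss) a (slot (iss ! a) b e)"
  using assms
proof (induction iss arbitrary: a)
  case (Cons js iss)
  then show ?case by (cases a) (auto simp: slot_def)
qed simp

lemma concat_nth_slot:
  assumes "a < length iss" "b < length (iss ! a)"
  shows "concat iss ! slot (map length iss) a b = iss ! a ! b"
  using assms
proof (induction iss arbitrary: a)
  case (Cons js iss)
  then show ?case by (cases a) (auto simp: slot_def nth_append)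
qed simp

lemma disk_comp_assoc:
  assumes c: "c \<in> disk_tuples (length iss)"
    and d: "\<And>a. a < length iss \<Longrightarrow> d a \<in> disk_tuples (length (iss ! a))"
    and e: "\<And>m. m < length (concat iss) \<Longrightarrow> e m \<in> disk_tuples (concat iss ! m)"
  shows "disk_comp (concat iss) (disk_comp (map length iss) c d) e =
    disk_comp (map sum_list iss) c
      (\<lambda>a\<in>{..<length iss}. disk_comp (iss ! a) (d a)
         (\<lambda>b\<in>{..<length (iss ! a)}. e (slot (map length iss) a b)))" (is "?L = ?R")
proof (rule extensionalityI[where A = "{..<sum_list (concat iss)}"])
  show "?L \<in> extensional {..<sum_list (concat iss)}" by (simp add: disk_comp_def)
  show "?R \<in> extensional {..<sum_list (concat iss)}"
    by (simp add: disk_comp_def sum_list_map_sum_list)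
  fix i assume "i \<in> {..<sum_list (concat iss)}"
  then have "i < sum_list (map sum_list iss)" by (simp add: sum_list_map_sum_list)
  then show "?L i = ?R i"
  proof (rule slot_cases)
    fix a l assume al: "a < length (map sum_list iss)" "l < map sum_list iss ! a"
      "i = slot (map sum_list iss) a l"
    from al have "l < sum_list (iss ! a)" by simp
    then show ?thesis
    proof (rule slot_cases)
      fix b n assume bn: "b < length (iss ! a)" "n < iss ! a ! b" "l = slot (iss ! a) b n"
      let ?m = "slot (map length iss) a b"
      have a: "a < length iss" using al by simp
      have m: "?m < length (concat iss)"
        using slot_less[of a "map length iss" b] a bn by (simp add: length_concat)
      have n: "n < concat iss ! ?m" using bn(2) unfolding concat_nth_slot[OF a bn(1)] .
      have i: "i = slot (concat iss) ?m n" using slot_concat a bn al by simp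
      have "?L i = compose disk (compose disk (c a) (d a b)) (e ?m n)"
        unfolding i disk_comp_slot[OF m n] using a bn by (simp add: disk_comp_slot)
      also have "\<dots> = compose disk (c a) (compose disk (d a b) (e ?m n))"
        using little_disk_maps_disk[OF disk_tuplesD(1)[OF e[OF m] n]]
        by (auto simp: compose_def fun_eq_iff)
      also have "\<dots> = ?R i"
        using a bn al by (simp add: disk_comp_slot)
      finally show ?thesis .
    qed
  qed
qed

lemma sum_list_permute_list:
  assumes "\<pi> permutes {..<length js}"
  shows "sum_list (permute_list \<pi> js) = sum_list (js :: nat list)"
  using assms by (metis mset_permute_list sum_mset_sum_list)

lemma disk_comp_perm_outer:
  assumes p: "\<pi> permutes {..<length js}"
  shows "disk_comp (permute_list \<pi> js) (\<lambda>i\<in>{..<length js}. c (\<pi> i)) (\<lambda>a\<in>{..<length js}. d (\<pi> a))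
    = (\<lambda>i\<in>{..<sum_list js}. disk_comp js c d (block_perm js \<pi> i))" (is "?L = ?R")
proof (rule extensionalityI[where A = "{..<sum_list js}"])
  show "?L \<in> extensional {..<sum_list js}"
    using sum_list_permute_list[OF p] by (simp add: disk_comp_def)
  show "?R \<in> extensional {..<sum_list js}" by simp
  fix i assume i: "i \<in> {..<sum_list js}"
  then have "i < sum_list (permute_list \<pi> js)" using sum_list_permute_list[OF p] by simp
  then show "?L i = ?R i"
  proof (rule slot_cases)
    fix a b assume ab: "a < length (permute_list \<pi> js)" "b < permute_list \<pi> js ! a"
      "i = slot (permute_list \<pi> js) a b"
    then have a: "a < length js" "\<pi> a < length js" "b < js ! \<pi> a"
      using permutes_in_image[OF p] by (auto simp: permute_list_nth p)
    then show ?thesis using ab i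
      by (simp add: disk_comp_slot block_perm_def unslot_slot)
  qed
qed

lemma disk_comp_perm_inner:
  assumes p: "\<And>a. a < length js \<Longrightarrow> \<tau> a permutes {..<js ! a}"
  shows "disk_comp js c (\<lambda>a\<in>{..<length js}. \<lambda>i\<in>{..<js ! a}. d a (\<tau> a i))
    = (\<lambda>i\<in>{..<sum_list js}. disk_comp js c d (block_sum js \<tau> i))" (is "?L = ?R")
proof (rule extensionalityI[where A = "{..<sum_list js}"])
  show "?L \<in> extensional {..<sum_list js}" by (simp add: disk_comp_def)
  show "?R \<in> extensional {..<sum_list js}" by simp
  fix i assume i: "i \<in> {..<sum_list js}"
  then have "i < sum_list js" by simp
  then show "?L i = ?R i"
  proof (rule slot_cases)
    fix a b assume ab: "a < length js" "b < js ! a" "i = slot js a b"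
    then have "\<tau> a b < js ! a" using permutes_in_image[OF p] by auto
    then show ?thesis using ab i by (simp add: disk_comp_slot block_sum_def unslot_slot)
  qed
qed

theorem topological_operad_E1: "topological_operad E1"
proof
  show "op_unit E1 \<in> topspace (ops E1 1)"
    using little_disk_id by (auto simp: disk_tuples_def)
  show "continuous_map (prod_topology (ops E1 (length js)) (op_tuples E1 js)) (ops E1 (sum_list js))
         (\<lambda>(p, q). op_comp E1 js p q)" for js
    using continuous_disk_comp by simp
  show "continuous_map (ops E1 n) (ops E1 n) (op_perm E1 n \<pi>)" if "\<pi> permutes {..<n}" for \<pi> n
    unfolding ops_E1 perm_E1
  proof (rule continuous_into_disk_space)
    fix i x assume "i < n" "x \<in> disk"
    moreover from this have "\<pi> i < n" using permutes_in_image[OF that] by auto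
    ultimately show "continuous_map (disk_space n) euclideanreal (\<lambda>c. (\<lambda>i\<in>{..<n}. c (\<pi> i)) i x)"
      using continuous_eval_disk by simp
  qed (use disk_perm_in[OF that] in simp)
  show "op_perm E1 n id p = p" if "p \<in> topspace (ops E1 n)" for n p
    using disk_tuplesD(2)[of p n] that by (simp add: extensional_restrict)
  show "op_perm E1 n (\<pi> \<circ> \<rho>) p = op_perm E1 n \<rho> (op_perm E1 n \<pi> p)"
    if "\<pi> permutes {..<n}" "\<rho> permutes {..<n}" for \<pi> \<rho> n p
    using permutes_in_image[OF that(2)] by (auto simp: fun_eq_iff restrict_def)
  show "op_comp E1 [n] (op_unit E1) (\<lambda>a\<in>{..<1}. p) = p" if "p \<in> topspace (ops E1 n)" for n p
  proof (rule extensionalityI[where A = "{..<n}"])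
    show "op_comp E1 [n] (op_unit E1) (\<lambda>a\<in>{..<1}. p) \<in> extensional {..<n}"
      by (simp add: disk_comp_def)
    show "p \<in> extensional {..<n}" using that disk_tuplesD(2) by simp
    fix i assume i: "i \<in> {..<n}"
    then have "p i \<in> little_disks" using that disk_tuplesD(1) by simp
    then have "compose disk (\<lambda>x\<in>disk. x) (p i) = p i"
      using little_disk_maps_disk little_disk_extensional
      by (intro extensionalityI[where A = disk]) (auto simp: compose_def)
    then show "op_comp E1 [n] (op_unit E1) (\<lambda>a\<in>{..<1}. p) i = p i"
      using i by (simp add: disk_comp_def)
  qed
  show "op_comp E1 (replicate n 1) p (\<lambda>a\<in>{..<n}. op_unit E1) = p"
    if "p \<in> topspace (ops E1 n)" for n p
  proof (rule extensionalityI[where A = "{..<n}"])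
    show "op_comp E1 (replicate n 1) p (\<lambda>a\<in>{..<n}. op_unit E1) \<in> extensional {..<n}"
      by (simp add: disk_comp_def sum_list_replicate)
    show "p \<in> extensional {..<n}" using that disk_tuplesD(2) by simp
    fix i assume i: "i \<in> {..<n}"
    then have "p i \<in> little_disks" using that disk_tuplesD(1) by simp
    then have *: "compose disk (p i) (\<lambda>x\<in>disk. x) = p i"
      using little_disk_extensional
      by (intro extensionalityI[where A = disk]) (auto simp: compose_def)
    have "slot (replicate n 1) i 0 = i" using i by (simp add: slot_def sum_list_replicate)
    then show "op_comp E1 (replicate n 1) p (\<lambda>a\<in>{..<n}. op_unit E1) i = p i"
      using disk_comp_slot[of i "replicate n 1" 0] i * by simp
  qed
  show "op_comp E1 (concat iss) (op_comp E1 (map length iss) p q) r =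
          op_comp E1 (map sum_list iss) p
            (\<lambda>a\<in>{..<length iss}. op_comp E1 (iss ! a) (q a)
              (\<lambda>b\<in>{..<length (iss ! a)}. r (slot (map length iss) a b)))"
    if "p \<in> topspace (ops E1 (length iss))" "q \<in> topspace (op_tuples E1 (map length iss))"
      "r \<in> topspace (op_tuples E1 (concat iss))" for iss p q r
    unfolding comp_E1 by (rule disk_comp_assoc) (use that in \<open>auto simp: PiE_iff\<close>)
  show "op_comp E1 (permute_list \<pi> js) (op_perm E1 (length js) \<pi> p) (\<lambda>a\<in>{..<length js}. q (\<pi> a)) =
          op_perm E1 (sum_list js) (block_perm js \<pi>) (op_comp E1 js p q)"
    if "\<pi> permutes {..<length js}" for \<pi> js p q
    using disk_comp_perm_outer[OF that] by simp
  show "op_comp E1 js p (\<lambda>a\<in>{..<length js}. op_perm E1 (js ! a) (\<tau> a) (q a)) =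
          op_perm E1 (sum_list js) (block_sum js \<tau>) (op_comp E1 js p q)"
    if "\<And>a. a < length js \<Longrightarrow> \<tau> a permutes {..<js ! a}" for js \<tau> p q
    using disk_comp_perm_inner[OF that] by simp
qed

lemma reflect_disk_in:
  assumes "f \<in> little_disks"
  shows "conjugate uminus uminus f \<in> little_disks"
    "conjugate uminus uminus f ` {-1<..<1} = uminus ` f ` {-1<..<1}"
proof -
  obtain r c where f: "r > 0" "r + \<bar>c\<bar> \<le> 1" "f = affine_disk r c"
    using assms by (rule little_disksE)
  then have "conjugate uminus uminus f = affine_disk r (- c)"
    by (auto simp: conjugate_def affine_disk_def)
  then show "conjugate uminus uminus f \<in> little_disks" using f little_disksI by simp
  have "conjugate uminus uminus f ` {-1<..<1} = (\<lambda>x. - f (- x)) ` {-1<..<1}"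
    by (intro image_cong) (auto simp: conjugate_def)
  also have "\<dots> = uminus ` f ` uminus ` {-1<..<1}" by (simp only: image_image)
  finally show "conjugate uminus uminus f ` {-1<..<1} = uminus ` f ` {-1<..<1}" by simp
qed

lemma conjugate_twice:
  "f \<in> little_disks \<Longrightarrow> conjugate uminus uminus (conjugate uminus uminus f) = f"
  using little_disk_extensional
  by (intro extensionalityI[where A = disk]) (auto simp: conjugate_def)

lemma conjugate_compose:
  "g \<in> little_disks \<Longrightarrow> conjugate uminus uminus (compose disk f g) =
     compose disk (conjugate uminus uminus f) (conjugate uminus uminus g)"
  using little_disk_maps_disk[of g]
  by (force simp: conjugate_def compose_def fun_eq_iff)

lemma reflect_disks_in: "c \<in> disk_tuples n \<Longrightarrow> reflect_disks n c \<in> disk_tuples n"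
  using reflect_disk_in
  by (auto simp: disk_tuples_def PiE_iff reflect_disks_def simp flip: image_Int)

lemma reflect_disks_twice: "c \<in> disk_tuples n \<Longrightarrow> reflect_disks n (reflect_disks n c) = c"
  using conjugate_twice disk_tuplesD
  by (intro extensionalityI[where A = "{..<n}"]) (auto simp: reflect_disks_def)

lemma operad_hom_reflect: "operad_hom E1 E1 reflect_disks"
proof
  show "continuous_map (ops E1 n) (ops E1 n) (reflect_disks n)" for n
    unfolding ops_E1
  proof (rule continuous_into_disk_space)
    fix i x assume *: "i < n" "x \<in> disk"
    then have "continuous_map (disk_space n) euclideanreal (\<lambda>c. - c i (- x))"
      by (intro continuous_map_minus continuous_eval_disk) auto
    then show "continuous_map (disk_space n) euclideanreal (\<lambda>c. reflect_disks n c i x)"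
      using * by (simp add: reflect_disks_def conjugate_def)
  qed (use reflect_disks_in in simp)
  show "reflect_disks 1 (op_unit E1) = op_unit E1"
    by (auto simp: reflect_disks_def conjugate_def fun_eq_iff)
  show "reflect_disks (sum_list js) (op_comp E1 js p q) =
      op_comp E1 js (reflect_disks (length js) p) (\<lambda>a\<in>{..<length js}. reflect_disks (js ! a) (q a))"
    if "p \<in> topspace (ops E1 (length js))" "q \<in> topspace (op_tuples E1 js)" for js p q
    unfolding comp_E1
  proof (rule extensionalityI[where A = "{..<sum_list js}"])
    fix i assume i: "i \<in> {..<sum_list js}"
    then have "i < sum_list js" by simp
    then show "reflect_disks (sum_list js) (disk_comp js p q) i =
        disk_comp js (reflect_disks (length js) p) (\<lambda>a\<in>{..<length js}. reflect_disks (js ! a) (q a)) i"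
    proof (rule slot_cases)
      fix a b assume ab: "a < length js" "b < js ! a" "i = slot js a b"
      then have "q a b \<in> little_disks"
        using that disk_tuplesD(1) by (fastforce simp: PiE_iff)
      then show ?thesis using ab i
        by (simp add: reflect_disks_def disk_comp_slot conjugate_compose)
    qed
  qed (simp_all add: reflect_disks_def disk_comp_def)
  show "reflect_disks n (op_perm E1 n \<pi> p) = op_perm E1 n \<pi> (reflect_disks n p)"
    if "\<pi> permutes {..<n}" for n \<pi> p
    using permutes_in_image[OF that] by (auto simp: reflect_disks_def fun_eq_iff restrict_def)
qed

theorem operad_automorphism_reflect: "operad_automorphism E1 reflect_disks"
  unfolding operad_automorphism_def
  using operad_hom_reflect reflect_disks_twice by auto

lemma carrier_C2: "carrier C2 = {0, 1}"
  by (auto simp: carrier_integer_mod_group)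

lemma sign_rep_0: "sign_rep 0 = id" and sign_rep_1: "sign_rep 1 = uminus"
  by (auto simp: sign_rep_def)

lemma inv_C2: "g \<in> carrier C2 \<Longrightarrow> inv\<^bsub>C2\<^esub> g = g"
  by (rule group.inv_equality[OF group_integer_mod_group])
     (auto simp: carrier_C2 mult_integer_mod_group)

lemma op_G_disks_sigma:
  assumes "c \<in> disk_tuples n"
  shows "op_G disks_sigma 0 n c = c" "op_G disks_sigma 1 n c = reflect_disks n c"
proof -
  have "conjugate id id f = f" if "f \<in> little_disks" for f
    using little_disk_extensional[OF that] by (auto simp: conjugate_def extensional_restrict)
  then show "op_G disks_sigma 0 n c = c"
    using assms disk_tuplesD[OF assms] inv_C2[of 0]
    by (intro extensionalityI[where A = "{..<n}"])
       (auto simp: disks_sigma_def sign_rep_0 carrier_C2)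
  show "op_G disks_sigma 1 n c = reflect_disks n c"
    using assms inv_C2[of 1] by (simp add: disks_sigma_def reflect_disks_def sign_rep_1 carrier_C2)
qed

lemma operad_hom_cong:
  assumes P: "topological_operad P" and h: "operad_hom P P h"
    and eq: "\<And>n p. p \<in> topspace (ops P n) \<Longrightarrow> k n p = h n p"
  shows "operad_hom P P k"
proof -
  interpret topological_operad P by (fact P)
  interpret h: operad_hom P P h by (fact h)
  show ?thesis
  proof
    show "continuous_map (ops P n) (ops P n) (k n)" for n
      using h.continuous_hom by (rule continuous_map_eq) (simp add: eq)
    show "k 1 (op_unit P) = op_unit P"
      using h.hom_unit eq unit_in by simp
    show "k (sum_list js) (op_comp P js p q) =
            op_comp P js (k (length js) p) (\<lambda>a\<in>{..<length js}. k (js ! a) (q a))"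
      if *: "p \<in> topspace (ops P (length js))" "q \<in> topspace (op_tuples P js)" for js p q
    proof -
      have "(p, q) \<in> topspace (prod_topology (ops P (length js)) (op_tuples P js))"
        using * by simp
      from continuous_map_image_subset_topspace[OF continuous_comp[of js]] this
      have "op_comp P js p q \<in> topspace (ops P (sum_list js))" by fastforce
      moreover have "(\<lambda>a\<in>{..<length js}. k (js ! a) (q a)) = (\<lambda>a\<in>{..<length js}. h (js ! a) (q a))"
        using * eq by (auto simp: PiE_iff fun_eq_iff restrict_def)
      ultimately show ?thesis using h.hom_comp[OF *] eq * by simp
    qed
    show "k n (op_perm P n \<pi> p) = op_perm P n \<pi> (k n p)"
      if *: "\<pi> permutes {..<n}" "p \<in> topspace (ops P n)" for \<pi> n p
    proof -
      have "op_perm P n \<pi> p \<in> topspace (ops P n)"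
        using continuous_map_image_subset_topspace[OF continuous_perm[OF *(1)]] *(2) by blast
      then show ?thesis using h.hom_perm[OF *] eq * by simp
    qed
  qed
qed

theorem equivariant_operad_disks_sigma: "equivariant_operad C2 disks_sigma"
proof -
  have op: "topological_operad disks_sigma"
    using topological_operad_E1 unfolding topological_operad_def by simp
  have id: "operad_hom disks_sigma disks_sigma (\<lambda>n c. c)"
    by unfold_locales (auto simp: extensional_restrict PiE_iff)
  have reflect: "operad_hom disks_sigma disks_sigma reflect_disks"
    using operad_hom_reflect unfolding operad_hom_def by simp
  have hom: "operad_hom disks_sigma disks_sigma (op_G disks_sigma g)" if g: "g \<in> carrier C2" for g
  proof (cases "g = 0")
    case True
    then show ?thesis
      using operad_hom_cong[OF op id, of "op_G disks_sigma g"] op_G_disks_sigma(1) by simp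
  next
    case False
    with g have "g = 1" by (simp add: carrier_C2)
    then show ?thesis
      using operad_hom_cong[OF op reflect, of "op_G disks_sigma g"] op_G_disks_sigma(2) by simp
  qed
  have "G_space C2 (disk_space n) (\<lambda>g. op_G disks_sigma g n)" for n
  proof -
    let ?\<phi> = "\<lambda>g. op_G disks_sigma g n" and ?E = "disk_tuples n"
    have ext: "?\<phi> g \<in> extensional ?E" for g by (simp add: disks_sigma_def)
    have \<phi>0: "?\<phi> 0 = (\<lambda>c\<in>?E. c)" and \<phi>1: "?\<phi> 1 = (\<lambda>c\<in>?E. reflect_disks n c)"
      using op_G_disks_sigma ext by (auto intro!: extensionalityI[where A = ?E])
    have bij: "?\<phi> g \<in> Bij ?E" if "g \<in> carrier C2" for g
    proof -
      have "bij_betw (?\<phi> 0) ?E ?E" by (simp add: \<phi>0 bij_betw_def inj_on_def)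
      moreover have "bij_betw (?\<phi> 1) ?E ?E"
        by (rule bij_betw_byWitness[where f' = "?\<phi> 1"])
           (auto simp: \<phi>1 reflect_disks_in reflect_disks_twice)
      ultimately show ?thesis using that ext by (auto simp: carrier_C2 Bij_def)
    qed
    have "group_hom C2 (BijGroup ?E) ?\<phi>"
    proof (intro group_hom.intro group_hom_axioms.intro homI)
      show "?\<phi> (x \<otimes>\<^bsub>C2\<^esub> y) = ?\<phi> x \<otimes>\<^bsub>BijGroup ?E\<^esub> ?\<phi> y"
        if xy: "x \<in> carrier C2" "y \<in> carrier C2" for x y
      proof -
        have "?\<phi> x \<otimes>\<^bsub>BijGroup ?E\<^esub> ?\<phi> y = compose ?E (?\<phi> x) (?\<phi> y)"
          using bij xy by (simp add: BijGroup_def)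
        also have "\<dots> = ?\<phi> (x \<otimes>\<^bsub>C2\<^esub> y)"
          using xy by (auto simp: carrier_C2 mult_integer_mod_group \<phi>0 \<phi>1 compose_def
            reflect_disks_in reflect_disks_twice fun_eq_iff)
        finally show ?thesis by simp
      qed
    qed (use bij in \<open>simp_all add: group_BijGroup, simp add: BijGroup_def\<close>)
    moreover have "continuous_map (disk_space n) (disk_space n) (?\<phi> g)" if "g \<in> carrier C2" for g
      using operad_hom.continuous_hom[OF hom[OF that], of n] by simp
    ultimately show ?thesis by (simp add: G_space_def group_action_def)
  qed
  then show ?thesis
    using op hom by (simp add: equivariant_operad_def equivariant_operad_axioms_def)
qed

end

theory Submission
  imports Defs
begin

text \<open>
  The non-trivial element \<open>t\<close> of \<^const>\<open>C2\<close> acts on little disks by conjugation with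
  \<open>x \<mapsto> - x\<close>, so \<open>op_G disks_sigma t\<close> and \<^const>\<open>reflect_disks\<close> agree on tuples of little disks.
  Equivariance of the structure maps of \<open>X\<close> therefore reads
  \<open>t (p \<cdot> (x\<^sub>1, \<dots>, x\<^sub>n)) = reflect_disks p \<cdot> (t x\<^sub>1, \<dots>, t x\<^sub>n)\<close>
  (lemma \<open>nontrivial_element_act\<close>), which is precisely the condition for \<open>t\<close> to be a homomorphism
  from \<open>X\<close> to its pullback along the reflection. Replacing \<open>p\<close> by its reflection and using that
  reflecting twice is the identity turns the same formula into the condition for \<open>t\<close> to be a
  homomorphism from the opposite algebra back to \<open>X\<close>. Since \<open>t\<close> squares to the identity, these
  two homomorphisms are mutually inverse.

  That the opposite algebra is an algebra at all is the general fact that algebras pull back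
  along homomorphisms of operads (lemma \<open>operad_algebra_pullback\<close>).
\<close>

lemma operad_algebra_pullback:
  assumes h: "operad_hom P Q h" and A: "operad_algebra Q A"
  shows "operad_algebra P (algebra_pullback h A)"
proof -
  interpret h: operad_hom P Q h by (fact h)
  interpret A: operad_algebra Q A by (fact A)
  have h_in: "h n p \<in> topspace (ops Q n)" if "p \<in> topspace (ops P n)" for n p
    using continuous_map_image_subset_topspace[OF h.continuous_hom[of n]] that by blast
  show ?thesis
    unfolding operad_algebra_def algebra_pullback_def algebra.simps
  proof (intro conjI allI impI)
    fix n
    let ?X = "power_space (alg_space A) n"
    have "continuous_map (prod_topology (ops P n) ?X) (prod_topology (ops Q n) ?X)
            (\<lambda>(p, x). (h n p, x))"
      using h.continuous_hom by (simp add: continuous_map_prod_top)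
    from continuous_map_compose[OF this A.continuous_act]
    show "continuous_map (prod_topology (ops P n) ?X) (alg_space A)
            (\<lambda>(p, x). alg_act A n (h n p) x)"
      by (simp add: o_def case_prod_unfold)
  next
    fix x assume "x \<in> topspace (power_space (alg_space A) 1)"
    then show "alg_act A 1 (h 1 (op_unit P)) x = x 0"
      unfolding h.hom_unit by (rule A.act_unit)
  next
    fix p js q x
    assume p: "p \<in> topspace (ops P (length js))" and q: "q \<in> topspace (op_tuples P js)"
      and x: "x \<in> topspace (power_space (alg_space A) (sum_list js))"
    let ?q = "\<lambda>a\<in>{..<length js}. h (js ! a) (q a)"
    have "?q \<in> topspace (op_tuples Q js)"
      using q h_in by (auto simp: PiE_iff)
    then have "alg_act A (sum_list js) (op_comp Q js (h (length js) p) ?q) x =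
        alg_act A (length js) (h (length js) p)
          (\<lambda>a\<in>{..<length js}. alg_act A (js ! a) (?q a) (\<lambda>b\<in>{..<js ! a}. x (slot js a b)))"
      by (intro A.act_comp h_in p x)
    then show "alg_act A (sum_list js) (h (sum_list js) (op_comp P js p q)) x =
        alg_act A (length js) (h (length js) p)
          (\<lambda>a\<in>{..<length js}. alg_act A (js ! a) (h (js ! a) (q a))
             (\<lambda>b\<in>{..<js ! a}. x (slot js a b)))"
      by (simp add: h.hom_comp[OF p q] cong: restrict_cong)
  next
    fix \<pi> n p x
    assume "\<pi> permutes {..<n}" "p \<in> topspace (ops P n)"
      "x \<in> topspace (power_space (alg_space A) n)"
    then show "alg_act A n (h n (op_perm P n \<pi> p)) x =
        alg_act A n (h n p) (\<lambda>i\<in>{..<n}. x (inv_into UNIV \<pi> i))"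
      by (simp only: h.hom_perm A.act_perm h_in)
  qed
qed

lemma underlying_algebra_simps:
  "alg_space (underlying_algebra A) = alg_space A"
  "alg_act (underlying_algebra A) = alg_act A"
  by (simp_all add: underlying_algebra_def algebra.truncate_def)

lemma opposite_algebra_simps:
  "alg_space (opposite_algebra A) = alg_space A"
  "alg_act (opposite_algebra A) n p = alg_act A n (reflect_disks n p)"
  by (simp_all add: opposite_algebra_def algebra_pullback_def)

lemma operad_algebra_underlying:
  assumes "operad_algebra disks_sigma A"
  shows "operad_algebra E1 (underlying_algebra A)"
  using assms by (simp add: operad_algebra_def underlying_algebra_simps)

text \<open>
  The action axiom carries the conjugation action of the given group element on the operation;
  for the element which acts as \<open>x \<mapsto> - x\<close> on the disk that action is the reflection, which is
  how the opposite structure enters.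
\<close>

lemma nontrivial_element_act:
  assumes "equivariant_algebra C2 disks_sigma X"
    and "p \<in> disk_tuples n" and "x \<in> topspace (power_space (alg_space X) n)"
  shows "alg_G X 1 (alg_act X n p x) =
           alg_act X n (reflect_disks n p) (\<lambda>i\<in>{..<n}. alg_G X 1 (x i))"
proof -
  interpret equivariant_algebra C2 disks_sigma X by fact
  show ?thesis
    using act_G[of 1 p n x] assms(2,3) op_G_disks_sigma(2) by (simp add: carrier_C2)
qed

lemma nontrivial_element_involution:
  assumes "G_space C2 Y \<phi>" and "y \<in> topspace Y"
  shows "\<phi> 1 (\<phi> 1 y) = y"
proof -
  interpret group_action C2 "topspace Y" \<phi> using assms(1) by (simp add: G_space_def)
  have "\<phi> (1 \<otimes>\<^bsub>C2\<^esub> 1) y = \<phi> 1 (\<phi> 1 y)"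
    using assms(2) by (intro composition_rule) (auto simp: carrier_C2)
  moreover have "\<phi> \<one>\<^bsub>C2\<^esub> y = y"
    using fun_cong[OF id_eq_one, of y] assms(2) by simp
  ultimately show ?thesis by (simp add: mult_integer_mod_group)
qed

theorem proposition2p27:
  fixes X :: "(int, nat \<Rightarrow> real \<Rightarrow> real, 'x) G_algebra"
    and t :: int
  assumes "equivariant_algebra C2 disks_sigma X"
    and "t \<in> carrier C2" and "t \<noteq> \<one>\<^bsub>C2\<^esub>"
  shows "algebra_iso E1 (underlying_algebra X) (opposite_algebra (underlying_algebra X)) (alg_G X t)"
proof -
  interpret X: equivariant_algebra C2 disks_sigma X by fact
  let ?A = "underlying_algebra X"
  let ?f = "alg_G X 1"
  have t: "t = 1" using assms(2,3) by (simp add: carrier_C2)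
  have A: "operad_algebra E1 ?A"
    by (rule operad_algebra_underlying) (rule X.operad_algebra_axioms)
  have Aop: "operad_algebra E1 (opposite_algebra ?A)"
    unfolding opposite_algebra_def by (rule operad_algebra_pullback[OF operad_hom_reflect A])
  have cont: "continuous_map (alg_space X) (alg_space X) ?f"
    using X.alg_G_space by (simp add: G_space_def carrier_C2)
  have act: "?f (alg_act X n p x) = alg_act X n (reflect_disks n p) (\<lambda>i\<in>{..<n}. ?f (x i))"
    if "p \<in> disk_tuples n" "x \<in> topspace (power_space (alg_space X) n)" for n p x
    using nontrivial_element_act[OF assms(1) that] .
  have "algebra_hom E1 ?A (opposite_algebra ?A) ?f"
    unfolding algebra_hom_def algebra_hom_axioms_def
      opposite_algebra_simps underlying_algebra_simps ops_E1 topspace_disk_space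
    using A Aop cont act by blast
  moreover have "algebra_hom E1 (opposite_algebra ?A) ?A ?f"
  proof -
    have "?f (alg_act X n (reflect_disks n p) x) = alg_act X n p (\<lambda>i\<in>{..<n}. ?f (x i))"
      if "p \<in> disk_tuples n" "x \<in> topspace (power_space (alg_space X) n)" for n p x
      using act[OF reflect_disks_in[OF that(1)] that(2)] reflect_disks_twice[OF that(1)] by simp
    then show ?thesis
      unfolding algebra_hom_def algebra_hom_axioms_def
        opposite_algebra_simps underlying_algebra_simps ops_E1 topspace_disk_space
      using A Aop cont by blast
  qed
  moreover have "?f (?f x) = x" if "x \<in> topspace (alg_space X)" for x
    using nontrivial_element_involution[OF X.alg_G_space that] .
  ultimately show ?thesis
    unfolding algebra_iso_def t opposite_algebra_simps underlying_algebra_simps by blast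
qed

end
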